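(* Let $d$ be a positive integer. Every Lebesgue measurable distance Kolmogorov set $A\subseteq\mathbb{R}^d$ is measure Kolmogorov.
   Context: $\lambda$ denotes Lebesgue measure on $\mathbb{R}^d$ and $|\cdot|$ the Euclidean norm; 1-Lipschitz is with respect to the Euclidean norm. A set $P\subseteq\mathbb{R}^d$ is called a polyhedron if its topological boundary $\partial P$ can be covered by finitely many (affine) hyperplanes. A bounded measurable set $A\subseteq\mathbb{R}^d$ is called measure Kolmogorov if for every $\varepsilon>0$ there is a 1-Lipschitz map $f:A\to\mathbb{R}^d$ such that $f(A)$ is a polyhedron and $\lambda(f(A))>\lambda(A)-\varepsilon$. A bounded set $A\subseteq\mathbb{R}^d$ is called distance Kolmogorov if for every $\varepsilon>0$ there is a 1-Lipschitz map $f:A\to\mathbb{R}^d$ such that $f(A)$ is a polyhedron and $|f(x)-x|\le\varepsilon$ for every $x\in A$. *)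

theory Defs
  imports "HOL-Analysis.Analysis"
begin

definition affine_hyperplane :: "'a::euclidean_space set \<Rightarrow> bool" where
  "affine_hyperplane H \<longleftrightarrow> (\<exists>a b. a \<noteq> 0 \<and> H = {x. a \<bullet> x = b})"

(* Not the constant polyhedron of HOL-Analysis (finite intersection of closed half-spaces):
   here a set need be neither convex nor closed. *)
definition polyhedral_set :: "'a::euclidean_space set \<Rightarrow> bool" where
  "polyhedral_set P \<longleftrightarrow>
     (\<exists>\<H>. finite \<H> \<and> (\<forall>H\<in>\<H>. affine_hyperplane H) \<and> frontier P \<subseteq> \<Union>\<H>)"

(* Maps A \<rightarrow> R^d are total functions of which only the values on A are constrained.
   The set f ` A is Lebesgue measurable, since its frontier is a null set, and bounded, so
   measure lebesgue (f ` A) is its genuine finite Lebesgue measure. *)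
definition measure_Kolmogorov :: "'a::euclidean_space set \<Rightarrow> bool" where
  "measure_Kolmogorov A \<longleftrightarrow> bounded A \<and> A \<in> sets lebesgue \<and>
     (\<forall>\<epsilon>>0. \<exists>f :: 'a \<Rightarrow> 'a. 1-lipschitz_on A f \<and> polyhedral_set (f ` A) \<and>
        measure lebesgue (f ` A) > measure lebesgue A - \<epsilon>)"

definition distance_Kolmogorov :: "'a::euclidean_space set \<Rightarrow> bool" where
  "distance_Kolmogorov A \<longleftrightarrow> bounded A \<and>
     (\<forall>\<epsilon>>0. \<exists>f :: 'a \<Rightarrow> 'a. 1-lipschitz_on A f \<and> polyhedral_set (f ` A) \<and>
        (\<forall>x\<in>A. norm (f x - x) \<le> \<epsilon>))"

end

theory Submission
  imports Defs
begin

text \<open>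
  The displacement \<open>f - id\<close> of a 1-Lipschitz map \<open>f\<close> on \<open>A\<close> is 2-Lipschitz and uniformly small, so
  extending it coordinatewise, with truncation, yields a small displacement of the whole space whose
  Lipschitz constant depends only on the dimension. The resulting \<open>F\<close> extends \<open>f\<close>. Choose \<open>K\<close>
  compact and \<open>U\<close> open with \<open>K \<subseteq> A \<subseteq> U\<close> and \<open>U - K\<close> of small measure. By Brouwer's theorem every
  point whose small neighbourhood lies in \<open>U\<close> is attained by \<open>F\<close> on \<open>U\<close>, hence
  \<open>K \<subseteq> f(A) \<union> F(U - A)\<close>, and \<open>F(U - A)\<close> has small measure because \<open>F\<close> is Lipschitz.
\<close>

section \<open>Bounded Lipschitz extension to the whole space\<close>

lemma lipschitz_on_min:
  fixes f g :: "'a::metric_space \<Rightarrow> real"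
  assumes "L-lipschitz_on X f" "L-lipschitz_on X g"
  shows "L-lipschitz_on X (\<lambda>x. min (f x) (g x))"
proof (rule lipschitz_onI)
  show "0 \<le> L"
    using assms(1) by (rule lipschitz_on_nonneg)
  fix x y assume "x \<in> X" "y \<in> X"
  then show "dist (min (f x) (g x)) (min (f y) (g y)) \<le> L * dist x y"
    using lipschitz_onD[OF assms(1), of x y] lipschitz_onD[OF assms(2), of x y]
    by (auto simp: dist_real_def min_def)
qed

text \<open>McShane's extension, truncated from above; the infimum already respects the lower bound.\<close>

lemma lipschitz_extend_bounded_real:
  fixes h :: "'a::metric_space \<Rightarrow> real"
  assumes lip: "L-lipschitz_on A h" and bd: "\<And>x. x \<in> A \<Longrightarrow> \<bar>h x\<bar> \<le> M" and "0 \<le> M"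
  obtains H where "L-lipschitz_on UNIV H" "\<And>x. x \<in> A \<Longrightarrow> H x = h x" "\<And>x. \<bar>H x\<bar> \<le> M"
proof (cases "A = {}")
  \<comment> \<open>The infimum of the empty set of reals satisfies no useful bounds, so this case
    takes the zero function.\<close>
  case True
  have "L-lipschitz_on UNIV (\<lambda>x::'a. 0::real)"
    using lipschitz_on_nonneg[OF lip] by (auto intro: lipschitz_onI)
  with True \<open>0 \<le> M\<close> show ?thesis
    by (intro that) auto
next
  case False
  have L0: "0 \<le> L"
    using lip by (rule lipschitz_on_nonneg)
  define H0 where "H0 x = (INF a\<in>A. h a + L * dist x a)" for x
  have lower: "- M \<le> h a + L * dist x a" if "a \<in> A" for a x
    using bd[OF that] L0 by (smt (verit) mult_nonneg_nonneg zero_le_dist)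
  have bdd: "bdd_below ((\<lambda>a. h a + L * dist x a) ` A)" for x
    using lower by (auto intro!: bdd_belowI[of _ "- M"])
  have ge: "- M \<le> H0 x" for x
    unfolding H0_def using False lower by (intro cINF_greatest) auto
  have step: "H0 x \<le> H0 y + L * dist x y" for x y
  proof -
    have "H0 x - L * dist x y \<le> H0 y"
      unfolding H0_def[of y]
    proof (rule cINF_greatest[OF False])
      fix a assume a: "a \<in> A"
      have "H0 x \<le> h a + L * dist x a"
        unfolding H0_def by (rule cINF_lower[OF bdd a])
      also have "L * dist x a \<le> L * (dist x y + dist y a)"
        by (intro mult_left_mono dist_triangle L0)
      finally show "H0 x - L * dist x y \<le> h a + L * dist y a"
        by (simp add: algebra_simps)
    qed
    then show ?thesis by simp
  qed
  \<comment> \<open>The competitor \<open>a = x\<close> gives the upper bound; the Lipschitz bound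
    of \<open>h\<close> on \<open>A\<close> says that no other \<open>a\<close> does better.\<close>
  have eq: "H0 x = h x" if x: "x \<in> A" for x
  proof (rule antisym)
    show "H0 x \<le> h x"
      unfolding H0_def using cINF_lower[OF bdd x, of x] by simp
    show "h x \<le> H0 x"
      unfolding H0_def
    proof (rule cINF_greatest[OF False])
      fix a assume "a \<in> A"
      then show "h x \<le> h a + L * dist x a"
        using lipschitz_onD[OF lip x, of a] by (auto simp: dist_real_def)
    qed
  qed
  have "L-lipschitz_on UNIV H0"
  proof (rule lipschitz_onI[OF _ L0])
    fix x y
    show "dist (H0 x) (H0 y) \<le> L * dist x y"
      using step[of x y] step[of y x] by (auto simp: dist_real_def dist_commute)
  qed
  moreover have "L-lipschitz_on UNIV (\<lambda>x::'a. M)"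
    using L0 by (auto intro: lipschitz_onI)
  ultimately have "L-lipschitz_on UNIV (\<lambda>x. min (H0 x) M)"
    by (rule lipschitz_on_min)
  moreover have "min (H0 x) M = h x" if "x \<in> A" for x
    using eq[OF that] bd[OF that] by auto
  moreover have "\<bar>min (H0 x) M\<bar> \<le> M" for x
    using ge[of x] \<open>0 \<le> M\<close> by auto
  ultimately show ?thesis
    by (rule that)
qed

text \<open>Each coordinate is extended separately with the same \<open>L\<close> and
  \<open>M\<close>. Reassembling the coordinates through the l1 norm costs the factor
  \<open>DIM('b)\<close> in both constants.\<close>

lemma lipschitz_extend_bounded:
  fixes g :: "'a::metric_space \<Rightarrow> 'b::euclidean_space"
  assumes lip: "L-lipschitz_on A g" and bd: "\<And>x. x \<in> A \<Longrightarrow> norm (g x) \<le> M" and "0 \<le> M"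
  obtains G where "(real DIM('b) * L)-lipschitz_on UNIV G" "\<And>x. x \<in> A \<Longrightarrow> G x = g x"
    "\<And>x. norm (G x) \<le> real DIM('b) * M"
proof -
  have L0: "0 \<le> L"
    using lip by (rule lipschitz_on_nonneg)
  have "\<exists>H. L-lipschitz_on UNIV H \<and> (\<forall>x\<in>A. H x = g x \<bullet> i) \<and> (\<forall>x. \<bar>H x\<bar> \<le> M)"
    if i: "i \<in> Basis" for i
  proof -
    have "L-lipschitz_on A (\<lambda>x. g x \<bullet> i)"
    proof (rule lipschitz_onI[OF _ L0])
      fix x y assume "x \<in> A" "y \<in> A"
      then have "dist (g x) (g y) \<le> L * dist x y"
        by (rule lipschitz_onD[OF lip])
      moreover have "dist (g x \<bullet> i) (g y \<bullet> i) \<le> dist (g x) (g y)"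
        using Basis_le_norm[OF i, of "g x - g y"]
        by (simp add: dist_norm inner_diff_left)
      ultimately show "dist (g x \<bullet> i) (g y \<bullet> i) \<le> L * dist x y"
        by linarith
    qed
    moreover have "\<bar>g x \<bullet> i\<bar> \<le> M" if "x \<in> A" for x
      using Basis_le_norm[OF i, of "g x"] bd[OF that] by linarith
    ultimately show ?thesis
      using \<open>0 \<le> M\<close> by (rule lipschitz_extend_bounded_real) blast+
  qed
  then obtain H where lipH: "\<And>i. i \<in> Basis \<Longrightarrow> L-lipschitz_on UNIV (H i)"
    and eqH: "\<And>i x. i \<in> Basis \<Longrightarrow> x \<in> A \<Longrightarrow> H i x = g x \<bullet> i"
    and bdH: "\<And>i x. i \<in> Basis \<Longrightarrow> \<bar>H i x\<bar> \<le> M"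
    by metis
  define G where "G x = (\<Sum>i\<in>Basis. H i x *\<^sub>R i)" for x
  have coord: "G x \<bullet> i = H i x" if "i \<in> Basis" for x i
    using that by (simp add: G_def)
  show ?thesis
  proof
    show "(real DIM('b) * L)-lipschitz_on UNIV G"
    proof (rule lipschitz_onI)
      fix x y
      have "dist (G x) (G y) \<le> (\<Sum>i\<in>Basis. \<bar>(G x - G y) \<bullet> i\<bar>)"
        unfolding dist_norm by (rule norm_le_l1)
      also have "\<dots> \<le> (\<Sum>i\<in>(Basis::'b set). L * dist x y)"
      proof (rule sum_mono)
        fix i :: 'b assume i: "i \<in> Basis"
        show "\<bar>(G x - G y) \<bullet> i\<bar> \<le> L * dist x y"
          using lipschitz_onD[OF lipH[OF i], of x y]
          by (simp add: inner_diff_left coord[OF i] dist_real_def)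
      qed
      finally show "dist (G x) (G y) \<le> real DIM('b) * L * dist x y"
        by simp
    qed (use L0 in simp)
    show "G x = g x" if "x \<in> A" for x
      by (rule euclidean_eqI) (simp add: coord eqH that)
    fix x
    have "norm (G x) \<le> (\<Sum>i\<in>Basis. \<bar>G x \<bullet> i\<bar>)"
      by (rule norm_le_l1)
    also have "\<dots> \<le> (\<Sum>i\<in>(Basis::'b set). M)"
      by (rule sum_mono) (simp add: coord bdH)
    finally show "norm (G x) \<le> real DIM('b) * M"
      by simp
  qed
qed

section \<open>Outer measure of Lipschitz images\<close>

text \<open>The diameter of a cube is at most the dimension times its side, so the image fits into a
  ball whose volume is a fixed multiple of that of the cube. The ball is centred at the image of a
  point of \<open>S\<close>, since \<open>f\<close> is controlled only there.\<close>

lemma lipschitz_image_cube_subset: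
  fixes f :: "'a::euclidean_space \<Rightarrow> 'b::metric_space"
  assumes "L-lipschitz_on S f" "x \<in> S \<inter> cbox u v"
    and side: "\<And>i. i \<in> Basis \<Longrightarrow> v \<bullet> i - u \<bullet> i = s"
  shows "f ` (S \<inter> cbox u v) \<subseteq> cball (f x) (L * (real DIM('a) * s))"
proof clarify
  fix y assume y: "y \<in> S" "y \<in> cbox u v"
  have "dist x y \<le> (\<Sum>i\<in>Basis. \<bar>(x - y) \<bullet> i\<bar>)"
    unfolding dist_norm by (rule norm_le_l1)
  also have "\<dots> \<le> (\<Sum>i\<in>(Basis::'a set). s)"
  proof (rule sum_mono)
    fix i :: 'a assume i: "i \<in> Basis"
    have "u \<bullet> i \<le> x \<bullet> i" "x \<bullet> i \<le> v \<bullet> i" "u \<bullet> i \<le> y \<bullet> i" "y \<bullet> i \<le> v \<bullet> i"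
      using i y assms(2) by (auto simp: mem_box)
    then show "\<bar>(x - y) \<bullet> i\<bar> \<le> s"
      using side[OF i] by (simp add: inner_diff_left)
  qed
  finally have "dist x y \<le> real DIM('a) * s"
    by simp
  then have "L * dist x y \<le> L * (real DIM('a) * s)"
    by (intro mult_left_mono lipschitz_on_nonneg[OF assms(1)])
  then show "f y \<in> cball (f x) (L * (real DIM('a) * s))"
    using lipschitz_onD[OF assms(1), of x y] y assms(2) by auto
qed

text \<open>Cover \<open>S\<close> by dyadic cubes with disjoint interiors inside an open set
  \<open>V\<close> of measure at most \<open>m\<close>, and enclose the image of each piece in a
  ball. The slack between the measure of \<open>S\<close> and \<open>m\<close> makes room for
  \<open>V\<close>. A measurable superset \<open>T\<close> stands for the outer measure of the
  image.\<close>

lemma lipschitz_image_outer_measure_le: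
  fixes f :: "'a::euclidean_space \<Rightarrow> 'a"
  assumes lip: "L-lipschitz_on S f" and "bounded S" and S: "S \<in> lmeasurable"
    and m: "measure lebesgue S < m"
  obtains T where "T \<in> lmeasurable" "f ` S \<subseteq> T"
    "measure lebesgue T \<le> unit_ball_vol (real DIM('a)) * (L * real DIM('a)) ^ DIM('a) * m"
proof -
  define C where "C = unit_ball_vol (real DIM('a)) * (L * real DIM('a)) ^ DIM('a)"
  have L0: "0 \<le> L"
    using lip by (rule lipschitz_on_nonneg)
  have C0: "0 \<le> C"
    using L0 by (simp add: C_def)
  have m0: "0 < m"
    using m measure_nonneg[of lebesgue S] by linarith
  obtain V where V: "open V" "S \<subseteq> V" "V - S \<in> lmeasurable"
    "emeasure lebesgue (V - S) < ennreal (m - measure lebesgue S)"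
    using sets_lebesgue_outer_open[of S "m - measure lebesgue S"] S m by auto
  have Vm: "V \<in> lmeasurable"
    using fmeasurable.Un[OF S V(3)] V(2) by (simp add: Un_absorb1)
  have "measure lebesgue V = measure lebesgue S + measure lebesgue (V - S)"
    using S Vm V(2) by (simp add: measurable_measure_Diff fmeasurableD)
  also have "\<dots> \<le> m"
    using V(3,4) m by (simp add: emeasure_eq_measure2 ennreal_less_iff)
  finally have mV: "measure lebesgue V \<le> m" .
  obtain c where c: "\<And>x. x \<in> S \<Longrightarrow> norm x \<le> c" and "c > 0"
    using \<open>bounded S\<close> by (auto simp: bounded_pos)
  \<comment> \<open>The enclosing box is a cube, so its dyadic subboxes are cubes too, of side
    \<open>2 * c / 2 ^ n\<close>.\<close>
  have sub: "S \<subseteq> cbox (- (c *\<^sub>R One)) (c *\<^sub>R One)"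
  proof
    fix x assume "x \<in> S"
    then show "x \<in> cbox (- (c *\<^sub>R One)) (c *\<^sub>R One)"
      using c[of x] Basis_le_norm[of _ x] by (fastforce simp: mem_box abs_le_iff)
  qed
  have ne: "box (- (c *\<^sub>R One)) (c *\<^sub>R One :: 'a) \<noteq> {}"
    using \<open>c > 0\<close> by (simp add: box_ne_empty)
  have "\<forall>x\<in>S. \<exists>r>0. ball x r \<subseteq> V"
    using V by (auto simp: open_contains_ball)
  then obtain r where r: "\<And>x. x \<in> S \<Longrightarrow> r x > 0 \<and> ball x (r x) \<subseteq> V"
    by metis
  \<comment> \<open>A gauge must be defined everywhere; the radius 1 off \<open>S\<close> is a
    dummy, because every cube of the covering is tagged by a point of \<open>S\<close>.\<close>
  define \<gamma> where "\<gamma> x = ball x (if x \<in> S then r x else 1)" for x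
  have "gauge \<gamma>"
    using r by (auto simp: gauge_def \<gamma>_def)
  obtain \<D> where cnt: "countable \<D>"
    and boxes: "\<And>K. K \<in> \<D> \<Longrightarrow> interior K \<noteq> {} \<and> (\<exists>u v. K = cbox u v)"
    and disj: "pairwise (\<lambda>A B. interior A \<inter> interior B = {}) \<D>"
    and fine: "\<And>K. K \<in> \<D> \<Longrightarrow> \<exists>x\<in>S \<inter> K. K \<subseteq> \<gamma> x"
    and sides: "\<And>u v. cbox u v \<in> \<D> \<Longrightarrow>
      \<exists>n. \<forall>i\<in>Basis. v \<bullet> i - u \<bullet> i = ((c *\<^sub>R One) \<bullet> i - (- (c *\<^sub>R One)) \<bullet> i) / 2 ^ n"
    and cover: "S \<subseteq> \<Union>\<D>"
    by (rule covering_lemma[OF sub ne \<open>gauge \<gamma>\<close>]) blast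
  have "\<exists>B. B \<in> lmeasurable \<and> f ` (S \<inter> K) \<subseteq> B \<and>
      measure lebesgue B \<le> C * measure lebesgue (interior K)" if K: "K \<in> \<D>" for K
  proof -
    obtain u v where uv: "K = cbox u v"
      using boxes[OF K] by blast
    obtain n where n: "\<And>i. i \<in> Basis \<Longrightarrow> v \<bullet> i - u \<bullet> i = 2 * c / 2 ^ n"
      using sides[of u v] K uv by auto
    define s where "s = 2 * c / 2 ^ n"
    have s0: "0 < s"
      using \<open>c > 0\<close> by (simp add: s_def)
    obtain x where x: "x \<in> S \<inter> cbox u v"
      using fine[OF K] uv by blast
    have le: "u \<bullet> i \<le> v \<bullet> i" if "i \<in> Basis" for i
      using n[OF that] s0 by (simp add: s_def)
    have "measure lebesgue (interior K) = (\<Prod>i\<in>Basis. (v - u) \<bullet> i)"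
      using le by (simp add: uv interior_cbox measure_lborel_box_eq inner_diff_left)
    also have "\<dots> = s ^ DIM('a)"
      using n by (simp add: s_def inner_diff_left)
    finally have vol: "measure lebesgue (interior K) = s ^ DIM('a)" .
    have "measure lebesgue (cball (f x) (L * (real DIM('a) * s)))
        = unit_ball_vol (real DIM('a)) * (L * (real DIM('a) * s)) ^ DIM('a)"
      using L0 s0 by (simp add: content_cball)
    also have "\<dots> = C * measure lebesgue (interior K)"
      by (simp add: vol C_def power_mult_distrib)
    finally show ?thesis
      using lipschitz_image_cube_subset[OF lip x, of s] n
      by (intro exI[of _ "cball (f x) (L * (real DIM('a) * s))"]) (auto simp: s_def uv)
  qed
  then obtain B where Bm: "\<And>K. K \<in> \<D> \<Longrightarrow> B K \<in> lmeasurable"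
    and Bs: "\<And>K. K \<in> \<D> \<Longrightarrow> f ` (S \<inter> K) \<subseteq> B K"
    and Be: "\<And>K. K \<in> \<D> \<Longrightarrow> measure lebesgue (B K) \<le> C * measure lebesgue (interior K)"
    by metis
  have DV: "K \<subseteq> V" if "K \<in> \<D>" for K
    using fine[OF that] r by (fastforce simp: \<gamma>_def)
  have intm: "interior K \<in> lmeasurable" if "K \<in> \<D>" for K
    using boxes[OF that] by (auto simp: interior_cbox)
  \<comment> \<open>A bound uniform over finite subfamilies passes to the countable union. Volumes
    are taken of interiors because the cubes themselves may share faces.\<close>
  have bound: "measure lebesgue (\<Union>K\<in>\<F>. B K) \<le> C * m" if \<F>: "\<F> \<subseteq> \<D>" "finite \<F>" for \<F>
  proof -
    have "measure lebesgue (\<Union>K\<in>\<F>. B K) \<le> (\<Sum>K\<in>\<F>. measure lebesgue (B K))"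
      using \<F> Bm by (intro measure_UNION_le) auto
    also have "\<dots> \<le> (\<Sum>K\<in>\<F>. C * measure lebesgue (interior K))"
      using \<F> Be by (intro sum_mono) auto
    also have "\<dots> = C * measure lebesgue (\<Union>K\<in>\<F>. interior K)"
      using \<F> disj intm
      by (subst measure_UNION')
        (auto simp: sum_distrib_left pairwise_def disjnt_def subset_iff)
    also have "\<dots> \<le> C * measure lebesgue V"
    proof (intro mult_left_mono measure_mono_fmeasurable Vm C0)
      show "(\<Union>K\<in>\<F>. interior K) \<subseteq> V"
        using \<F> DV interior_subset by blast
    qed (intro sets.finite_UN, use \<F> intm in auto)
    also have "\<dots> \<le> C * m"
      using mV C0 by (rule mult_left_mono)
    finally show ?thesis .
  qed
  show ?thesis
  proof
    show "(\<Union>K\<in>\<D>. B K) \<in> lmeasurable"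
      by (rule fmeasurable_UN_bound[OF cnt Bm bound])
    show "f ` S \<subseteq> (\<Union>K\<in>\<D>. B K)"
      using cover Bs by blast
    show "measure lebesgue (\<Union>K\<in>\<D>. B K)
        \<le> unit_ball_vol (real DIM('a)) * (L * real DIM('a)) ^ DIM('a) * m"
      unfolding C_def[symmetric] by (rule measure_UN_bound[OF cnt Bm bound])
  qed
qed

section \<open>Polyhedral images and small displacements\<close>

lemma negligible_affine_hyperplane: "affine_hyperplane H \<Longrightarrow> negligible H"
  by (auto simp: affine_hyperplane_def intro: negligible_hyperplane)

text \<open>Finitely many hyperplanes form a null set, so the frontier is negligible and the Jordan
  criterion applies.\<close>

lemma polyhedral_set_lmeasurable:
  assumes "polyhedral_set P" "bounded P"
  shows "P \<in> lmeasurable"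
proof -
  obtain \<H> where \<H>: "finite \<H>" "\<forall>H\<in>\<H>. affine_hyperplane H" "frontier P \<subseteq> \<Union>\<H>"
    using assms(1) by (auto simp: polyhedral_set_def)
  then have "negligible (\<Union>\<H>)"
    using negligible_affine_hyperplane by (blast intro: negligible_Union)
  then show ?thesis
    using \<H>(3) assms(2) negligible_subset measurable_Jordan by blast
qed

text \<open>The preimage of \<open>x\<close> is a fixed point of \<open>z \<mapsto> x - G z\<close>.\<close>

lemma small_displacement_covers:
  fixes G :: "'a::euclidean_space \<Rightarrow> 'a"
  assumes "continuous_on (cball x r) G" "\<And>z. z \<in> cball x r \<Longrightarrow> norm (G z) \<le> r" "r > 0"
  obtains z where "z \<in> cball x r" "z + G z = x"
proof -
  have "\<exists>z\<in>cball x r. z + G z = x"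
    by (rule brouwer_surjective_cball[where S="{x}"])
      (use assms in \<open>auto intro!: continuous_intros simp: dist_norm\<close>)
  then show ?thesis
    using that by blast
qed

section \<open>Comparison of the measures of A and f(A)\<close>

theorem theorem1p7:
  fixes A :: "(real ^ 'd) set"
  assumes "A \<in> sets lebesgue"
    and "distance_Kolmogorov A"
  shows "measure_Kolmogorov A"
proof -
  have bA: "bounded A"
    using assms(2) by (simp add: distance_Kolmogorov_def)
  have A: "A \<in> lmeasurable"
    using bA assms(1) by (simp add: bounded_set_imp_lmeasurable)
  let ?n = "DIM(real ^ 'd)"
  \<comment> \<open>Lipschitz constant of \<open>F\<close>: 1 from the identity, and the extension
    factor \<open>?n\<close> times 2 from the displacement. As \<open>L\<close> and \<open>C\<close>
    depend only on the dimension, \<open>\<delta>\<close> and \<open>U\<close> can be fixed before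
    \<open>f\<close> is chosen.\<close>
  define L where "L = 1 + real ?n * 2"
  define C where "C = unit_ball_vol (real ?n) * (L * real ?n) ^ ?n"
  have C0: "0 \<le> C"
    by (simp add: C_def L_def)
  have "\<exists>f :: real ^ 'd \<Rightarrow> real ^ 'd. 1-lipschitz_on A f \<and> polyhedral_set (f ` A) \<and>
      measure lebesgue (f ` A) > measure lebesgue A - e" if "e > 0" for e :: real
  proof -
    \<comment> \<open>Half of \<open>e\<close> pays for passing from \<open>A\<close> to
      \<open>K\<close>, half for the image of \<open>U - A\<close>. Using \<open>C + 1\<close>
      avoids a zero denominator and makes the second bound strict.\<close>
    define \<delta> where "\<delta> = e / (2 * (C + 1))"
    have \<delta>: "\<delta> > 0" "C * \<delta> < e / 2"
      using \<open>e > 0\<close> C0 by (auto simp: \<delta>_def field_simps)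
    obtain K where K: "closed K" "K \<subseteq> A" "A - K \<in> lmeasurable"
      "emeasure lebesgue (A - K) < ennreal (e / 2)"
      using sets_lebesgue_inner_closed[OF assms(1), of "e / 2"] \<open>e > 0\<close> by auto
    have "compact K"
      using K bA bounded_subset compact_eq_bounded_closed by blast
    then have Km: "K \<in> lmeasurable"
      by (rule lmeasurable_compact)
    have "measure lebesgue (A - K) < e / 2"
      using K(3,4) \<open>e > 0\<close> by (simp add: emeasure_eq_measure2 ennreal_less_iff)
    then have mK: "measure lebesgue A - e / 2 < measure lebesgue K"
      using K A Km by (simp add: measurable_measure_Diff)
    obtain U0 where U0: "open U0" "A \<subseteq> U0" "U0 - A \<in> lmeasurable"
      "emeasure lebesgue (U0 - A) < ennreal \<delta>"
      using sets_lebesgue_outer_open[OF assms(1) \<delta>(1)] by auto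
    obtain R where R: "A \<subseteq> ball 0 R"
      using bA bounded_subset_ballD by blast
    \<comment> \<open>The truncation makes \<open>U - A\<close> bounded, as the estimate for
      Lipschitz images requires.\<close>
    define U where "U = U0 \<inter> ball 0 R"
    have U: "open U" "A \<subseteq> U" "bounded U"
      using U0 R by (auto simp: U_def intro: bounded_subset[OF bounded_ball])
    have UA: "U - A \<in> lmeasurable" "bounded (U - A)"
      using U assms(1) by (auto intro!: bounded_set_imp_lmeasurable bounded_diff)
    have "measure lebesgue (U - A) \<le> measure lebesgue (U0 - A)"
      using UA U0 by (intro measure_mono_fmeasurable) (auto simp: U_def)
    also have "\<dots> < \<delta>"
      using U0(3,4) \<delta>(1) by (simp add: emeasure_eq_measure2 ennreal_less_iff)
    finally have mUA: "measure lebesgue (U - A) < \<delta>" .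
    obtain \<rho> where \<rho>: "\<rho> > 0" "(\<Union>x\<in>K. cball x \<rho>) \<subseteq> U"
      using compact_subset_open_imp_cball_epsilon_subset[OF \<open>compact K\<close> U(1)] K U by blast
    \<comment> \<open>Extending the displacement multiplies its bound by \<open>?n\<close>; this
      choice brings it back to \<open>\<rho>\<close>.\<close>
    define \<epsilon> where "\<epsilon> = \<rho> / real ?n"
    have \<epsilon>: "\<epsilon> > 0" "real ?n * \<epsilon> = \<rho>"
      using \<rho> by (auto simp: \<epsilon>_def)
    obtain f where f: "1-lipschitz_on A f" "polyhedral_set (f ` A)"
      "\<And>x. x \<in> A \<Longrightarrow> norm (f x - x) \<le> \<epsilon>"
      using assms(2) \<epsilon> by (auto simp: distance_Kolmogorov_def)
    have "(1 + 1)-lipschitz_on A (\<lambda>x. f x - x)"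
      by (intro lipschitz_on_diff f lipschitz_on_id)
    then have lip: "2-lipschitz_on A (\<lambda>x. f x - x)"
      by simp
    obtain G where G: "(real ?n * 2)-lipschitz_on UNIV G"
      "\<And>x. x \<in> A \<Longrightarrow> G x = f x - x" "\<And>x. norm (G x) \<le> real ?n * \<epsilon>"
      by (rule lipschitz_extend_bounded[OF lip, of \<epsilon>])
        (use f(3) \<epsilon>(1) in \<open>blast intro: less_imp_le\<close>)+
    have contG: "continuous_on X G" for X
      using lipschitz_on_continuous_on[OF G(1)] continuous_on_subset by blast
    define F where "F x = x + G x" for x
    have lipF: "L-lipschitz_on (U - A) F"
      unfolding L_def F_def
      by (intro lipschitz_on_add lipschitz_on_id lipschitz_on_subset[OF G(1)]) simp
    have FA: "F ` A = f ` A"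
      using G(2) by (auto simp: F_def)
    obtain T where T: "T \<in> lmeasurable" "F ` (U - A) \<subseteq> T" "measure lebesgue T \<le> C * \<delta>"
      using lipschitz_image_outer_measure_le[OF lipF UA(2,1) mUA] unfolding C_def by blast
    have fA: "f ` A \<in> lmeasurable"
      using f(1,2) bA
      by (intro polyhedral_set_lmeasurable bounded_uniformly_continuous_image
          lipschitz_on_uniformly_continuous)
    \<comment> \<open>For \<open>x\<close> in \<open>K\<close> the ball of radius
      \<open>\<rho>\<close> lies in \<open>U\<close>, so the preimage found by Brouwer's theorem
      does too. It lies either in \<open>A\<close>, where \<open>F\<close> is \<open>f\<close>, or
      in \<open>U - A\<close>, whose image is inside \<open>T\<close>.\<close>
    have "K \<subseteq> F ` U"
    proof
      fix x assume "x \<in> K"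
      obtain z where "z \<in> cball x \<rho>" "z + G z = x"
        using small_displacement_covers[OF contG _ \<rho>(1)] G(3) \<epsilon>(2) by metis
      then show "x \<in> F ` U"
        using \<rho>(2) \<open>x \<in> K\<close> by (force simp: F_def)
    qed
    also have "\<dots> \<subseteq> f ` A \<union> T"
      using FA T(2) by blast
    finally have "measure lebesgue K \<le> measure lebesgue (f ` A \<union> T)"
      using Km fA T(1) by (intro measure_mono_fmeasurable) auto
    also have "\<dots> \<le> measure lebesgue (f ` A) + measure lebesgue T"
      using fA T(1) by (intro measure_Un_le) auto
    finally have "measure lebesgue (f ` A) > measure lebesgue A - e"
      using mK T(3) \<delta>(2) by linarith
    with f(1,2) show ?thesis
      by blast
  qed
  with bA assms(1) show ?thesis
    by (auto simp: measure_Kolmogorov_def)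
qed

end
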